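(* Let $m\ge 1$ and for $1\le k\le m$ let $N_k\ge 2$ be a real number and $B_k\subset\mathbb{R}$ a nonempty finite set. Let $\Omega=\{1,\dots,m\}^{\infty}$. Then for every sequence $\mathbf{n}=\{n_k\}_{k=1}^\infty$ of positive integers, the mapping $$\mu^{\mathbf n}:\Omega\times\mathcal{B}(\mathbb{R})\to[0,+\infty],\qquad \mu^{\mathbf n}(\omega,B)=\mu^{\mathbf n}(\omega)(B),$$ where $\mu^{\mathbf n}(\omega)=\delta_{N_{\omega_1}^{-n_1}B_{\omega_1}}*\delta_{N_{\omega_1}^{-n_1}N_{\omega_2}^{-n_2}B_{\omega_2}}*\cdots$ for $\omega=\omega_1\omega_2\cdots\in\Omega$, is a random measure on $(\mathbb{R},\mathcal{B}(\mathbb{R}))$ with respect to $(\Omega,\mathcal{F})$.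
   Context: For a nonempty finite set $D\subset\mathbb{R}$, $\delta_D=\frac{1}{\#D}\sum_{a\in D}\delta_a$, where $\delta_a$ is the Dirac measure at $a$; for $c\in\mathbb{R}$, $cD=\{ca:a\in D\}$. The infinite convolution $\mu^{\mathbf n}(\omega)$ is the weak limit, as $k\to\infty$, of the finite convolutions $\delta_{N_{\omega_1}^{-n_1}B_{\omega_1}}*\cdots*\delta_{N_{\omega_1}^{-n_1}\cdots N_{\omega_k}^{-n_k}B_{\omega_k}}$ (it exists for every $\omega\in\Omega$). $\Omega$ carries the metric $d(\alpha,\beta)=2^{-|\alpha\wedge\beta|}$ for $\alpha\ne\beta$ (and $d(\alpha,\alpha)=0$), where $|\alpha\wedge\beta|$ is the length of the longest common prefix of $\alpha$ and $\beta$; $\mathcal{F}$ is the Borel $\sigma$-algebra of $(\Omega,d)$, and $\mathcal{B}(\mathbb{R})$ is the Borel $\sigma$-algebra of $\mathbb{R}$. Given measurable spaces $(\Omega,\mathcal{F})$ and $(E,\mathcal{B})$, a mapping $M:\Omega\times\mathcal{B}\to[0,+\infty]$ is a random measure on $(E,\mathcal{B})$ if (i) $\omega\mapsto M(\omega,B)$ is $\mathcal{F}$-measurable for every $B\in\mathcal{B}$, and (ii) $B\mapsto M(\omega,B)$ is a measure on $(E,\mathcal{B})$ for every $\omega\in\Omega$. *)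

theory Defs
  imports "HOL-Probability.Probability"
begin

text \<open>
  Infinite words \<open>\<omega> = \<omega>\<^sub>1\<omega>\<^sub>2\<dots>\<close> and the sequence \<open>n = (n\<^sub>k)\<close> are functions on \<^typ>\<open>nat\<close>, so the
  position \<open>k \<ge> 1\<close> is represented by the argument \<open>k - 1\<close>. Letters keep their values in
  \<open>{1..m}\<close>.
\<close>

definition words :: "nat \<Rightarrow> (nat \<Rightarrow> nat) set" where
  "words m = (UNIV \<rightarrow> {1..m})"

definition common_prefix_length :: "(nat \<Rightarrow> nat) \<Rightarrow> (nat \<Rightarrow> nat) \<Rightarrow> nat" where
  "common_prefix_length \<alpha> \<beta> = (GREATEST l. \<forall>i<l. \<alpha> i = \<beta> i)"

definition word_dist :: "(nat \<Rightarrow> nat) \<Rightarrow> (nat \<Rightarrow> nat) \<Rightarrow> real" where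
  "word_dist \<alpha> \<beta> = (if \<alpha> = \<beta> then 0 else 2 powi (- int (common_prefix_length \<alpha> \<beta>)))"

lemma common_prefix_length_ge_iff:
  assumes "\<alpha> \<noteq> \<beta>"
  shows "l \<le> common_prefix_length \<alpha> \<beta> \<longleftrightarrow> (\<forall>i<l. \<alpha> i = \<beta> i)"
proof -
  let ?P = "\<lambda>l. \<forall>i<l. \<alpha> i = \<beta> i"
  obtain j where j: "\<alpha> j \<noteq> \<beta> j"
    using assms by blast
  have bound: "\<forall>l. ?P l \<longrightarrow> l \<le> j"
    using j by (meson not_le)
  have "?P (common_prefix_length \<alpha> \<beta>)"
    unfolding common_prefix_length_def by (rule GreatestI_nat[of ?P 0 j]) (use bound in auto)
  moreover have "l \<le> common_prefix_length \<alpha> \<beta>" if "?P l"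
    unfolding common_prefix_length_def by (rule Greatest_le_nat[of ?P l j]) (use bound that in auto)
  ultimately show ?thesis
    by (meson order_less_le_trans)
qed

lemma word_dist_ultrametric: "word_dist \<alpha> \<gamma> \<le> max (word_dist \<alpha> \<beta>) (word_dist \<beta> \<gamma>)"
proof (cases "\<alpha> = \<beta> \<or> \<beta> = \<gamma> \<or> \<alpha> = \<gamma>")
  case True
  then show ?thesis
    by (auto simp: word_dist_def le_max_iff_disj)
next
  case False
  then have ne: "\<alpha> \<noteq> \<beta>" "\<beta> \<noteq> \<gamma>" "\<alpha> \<noteq> \<gamma>"
    by auto
  have "min (common_prefix_length \<alpha> \<beta>) (common_prefix_length \<beta> \<gamma>) \<le> common_prefix_length \<alpha> \<gamma>"
    using common_prefix_length_ge_iff[OF ne(1), of "common_prefix_length \<alpha> \<beta>"]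
      common_prefix_length_ge_iff[OF ne(2), of "common_prefix_length \<beta> \<gamma>"]
    by (auto simp: common_prefix_length_ge_iff[OF ne(3)])
  then have "common_prefix_length \<alpha> \<beta> \<le> common_prefix_length \<alpha> \<gamma> \<or>
      common_prefix_length \<beta> \<gamma> \<le> common_prefix_length \<alpha> \<gamma>"
    by linarith
  then show ?thesis
    using ne by (auto simp: word_dist_def le_max_iff_disj intro!: power_int_increasing)
qed

lemma Metric_space_words: "Metric_space (words m) word_dist"
proof
  show "0 \<le> word_dist \<alpha> \<beta>" for \<alpha> \<beta>
    by (simp add: word_dist_def)
  show "word_dist \<alpha> \<beta> = word_dist \<beta> \<alpha>" for \<alpha> \<beta>
    by (simp add: word_dist_def common_prefix_length_def eq_commute)
  show "(word_dist \<alpha> \<beta> = 0) = (\<alpha> = \<beta>)" for \<alpha> \<beta>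
    by (simp add: word_dist_def)
  show "word_dist \<alpha> \<gamma> \<le> word_dist \<alpha> \<beta> + word_dist \<beta> \<gamma>" for \<alpha> \<beta> \<gamma>
  proof -
    have "0 \<le> word_dist \<alpha> \<beta>" "0 \<le> word_dist \<beta> \<gamma>"
      by (simp_all add: word_dist_def)
    then show ?thesis
      using word_dist_ultrametric[of \<alpha> \<gamma> \<beta>] by linarith
  qed
qed

definition words_borel :: "nat \<Rightarrow> (nat \<Rightarrow> nat) measure" where
  "words_borel m =
     sigma (words m) {U. openin (Metric_space.mtopology (words m) word_dist) U}"

lemma space_words_borel [simp]: "space (words_borel m) = words m"
  by (simp add: words_borel_def space_measure_of_conv)

lemma sets_words_borel:
  "sets (words_borel m) =
     sigma_sets (words m) {U. openin (Metric_space.mtopology (words m) word_dist) U}"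
  unfolding words_borel_def
proof (rule sets_measure_of)
  interpret Metric_space "words m" word_dist
    by (rule Metric_space_words)
  show "{U. openin mtopology U} \<subseteq> Pow (words m)"
    by (auto simp: openin_mtopology)
qed

definition average_dirac :: "real set \<Rightarrow> real measure" where
  "average_dirac D =
     measure_of UNIV (sets borel) (\<lambda>A. (\<Sum>a\<in>D. emeasure (return borel a) A) / of_nat (card D))"

lemma sets_average_dirac [simp]: "sets (average_dirac D) = sets borel"
  unfolding average_dirac_def by (metis sets.sets_measure_of_eq space_borel)

lemma space_average_dirac [simp]: "space (average_dirac D) = UNIV"
  by (simp add: average_dirac_def space_measure_of_conv)

lemma emeasure_average_dirac:
  assumes "A \<in> sets borel"
  shows "emeasure (average_dirac D) A =
    (\<Sum>a\<in>D. emeasure (return borel a) A) / of_nat (card D)"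
  unfolding average_dirac_def
proof (rule emeasure_measure_of_sigma[OF _ _ _ assms])
  let ?\<mu> = "\<lambda>A. (\<Sum>a\<in>D. emeasure (return borel a) A) / of_nat (card D)"
  show "sigma_algebra UNIV (sets (borel :: real measure))"
    using sets.sigma_algebra_axioms[of "borel :: real measure"] by simp
  show "positive (sets borel) ?\<mu>"
    by (simp add: positive_def)
  show "countably_additive (sets borel) ?\<mu>"
  proof (rule countably_additiveI)
    fix F :: "nat \<Rightarrow> real set"
    assume F: "range F \<subseteq> sets borel" "disjoint_family F"
    have "(\<Sum>i. ?\<mu> (F i)) = (\<Sum>i. \<Sum>a\<in>D. emeasure (return borel a) (F i)) / of_nat (card D)"
      by (simp add: divide_ennreal_def ennreal_suminf_multc)
    also have "(\<Sum>i. \<Sum>a\<in>D. emeasure (return borel a) (F i)) =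
        (\<Sum>a\<in>D. \<Sum>i. emeasure (return borel a) (F i))"
      by (rule suminf_sum) simp
    also have "\<dots> = (\<Sum>a\<in>D. emeasure (return borel a) (\<Union>i. F i))"
      by (intro sum.cong refl suminf_emeasure) (use F in auto)
    finally show "(\<Sum>i. ?\<mu> (F i)) = ?\<mu> (\<Union>i. F i)" .
  qed
qed

text \<open>
  The convolution of the first \<open>k\<close> factors; the empty convolution is the neutral element \<open>\<delta>\<^sub>0\<close>.
\<close>

primrec finite_convolution ::
  "(nat \<Rightarrow> real) \<Rightarrow> (nat \<Rightarrow> real set) \<Rightarrow> (nat \<Rightarrow> nat) \<Rightarrow> (nat \<Rightarrow> nat) \<Rightarrow> nat \<Rightarrow> real measure"
where
  "finite_convolution N B n \<omega> 0 = return borel 0"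
| "finite_convolution N B n \<omega> (Suc k) =
     (finite_convolution N B n \<omega> k \<star>
       average_dirac ((\<lambda>a. (\<Prod>j\<le>k. N (\<omega> j) powi (- int (n j))) * a) ` B (\<omega> k)))"

text \<open>
  The limit is taken among probability measures on the Borel sets, where \<^const>\<open>weak_conv_m\<close> is weak
  convergence and determines the limit uniquely.
\<close>

definition infinite_convolution ::
  "(nat \<Rightarrow> real) \<Rightarrow> (nat \<Rightarrow> real set) \<Rightarrow> (nat \<Rightarrow> nat) \<Rightarrow> (nat \<Rightarrow> nat) \<Rightarrow> real measure"
where
  "infinite_convolution N B n \<omega> =
     (THE \<mu>. real_distribution \<mu> \<and> weak_conv_m (finite_convolution N B n \<omega>) \<mu>)"

text \<open>
  In \<open>random_measure \<F> \<E> M\<close> the arguments \<open>\<F>\<close> and \<open>\<E>\<close> serve only as measurable spaces.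
\<close>

definition random_measure ::
  "'a measure \<Rightarrow> 'b measure \<Rightarrow> ('a \<Rightarrow> 'b set \<Rightarrow> ennreal) \<Rightarrow> bool"
where
  "random_measure \<F> \<E> M \<longleftrightarrow>
     (\<forall>B\<in>sets \<E>. (\<lambda>\<omega>. M \<omega> B) \<in> borel_measurable \<F>) \<and>
     (\<forall>\<omega>\<in>space \<F>. measure_space (space \<E>) (sets \<E>) (M \<omega>))"

end

theory Submission
  imports Defs
begin

text \<open>
  For fixed \<open>\<omega>\<close> the finite convolutions are the laws of the partial sums of independent random
  variables, the \<open>k\<close>-th bounded by a constant times \<open>2\<^sup>-\<^sup>k\<close>. The partial sums converge almost surely,
  hence in law, so the infinite convolution exists. The \<open>k\<close>-th finite convolution depends only on the
  first \<open>k\<close> letters of \<open>\<omega>\<close>, so it is locally constant in \<open>\<omega>\<close> and therefore a measurable kernel, and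
  a pointwise weak limit of measurable probability kernels is a measurable kernel: integrals of
  continuous cutoffs are limits of measurable functions, and they recover the distribution function.
\<close>

section \<open>Weak limits and characteristic functions\<close>

text \<open>This supplies the uniqueness behind the \<open>THE\<close> in
  \<open>infinite_convolution\<close>. By Levy continuity the characteristic functions of
  \<open>M k\<close> converge pointwise to those of both limits, and a characteristic function
  determines its distribution.\<close>

lemma weak_conv_m_unique:
  assumes "\<And>k. real_distribution (M k)" "real_distribution \<mu>" "real_distribution \<nu>"
    and "weak_conv_m M \<mu>" "weak_conv_m M \<nu>"
  shows "\<mu> = \<nu>"
proof (rule Levy_uniqueness)
  show "char \<mu> = char \<nu>"
  proof
    fix t
    show "char \<mu> t = char \<nu> t"
      by (rule LIMSEQ_unique[OF levy_continuity1 levy_continuity1]) (use assms in auto)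
  qed
qed (use assms in auto)

text \<open>Since \<open>iexp\<close> has norm 1, dominated convergence turns almost sure
  convergence into pointwise convergence of the characteristic functions, and Levy continuity
  applies.\<close>

lemma (in prob_space) AE_conv_imp_weak_conv_m:
  fixes X :: "nat \<Rightarrow> 'a \<Rightarrow> real"
  assumes [measurable]: "\<And>k. random_variable borel (X k)" "random_variable borel Y"
    and conv: "AE x in M. (\<lambda>k. X k x) \<longlonglongrightarrow> Y x"
  shows "weak_conv_m (\<lambda>k. distr M borel (X k)) (distr M borel Y)"
proof (rule levy_continuity)
  fix t
  have "(\<lambda>k. CLINT x|M. iexp (t * X k x)) \<longlonglongrightarrow> (CLINT x|M. iexp (t * Y x))"
  proof (rule integral_dominated_convergence[where w = "\<lambda>_. 1"])
    show "AE x in M. (\<lambda>k. iexp (t * X k x)) \<longlonglongrightarrow> iexp (t * Y x)"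
      using conv by eventually_elim (intro tendsto_intros)
  qed auto
  then show "(\<lambda>k. char (distr M borel (X k)) t) \<longlonglongrightarrow> char (distr M borel Y) t"
    by (simp add: char_def integral_distr)
qed auto

text \<open>The joint law of the coordinates is the product measure itself, and the factors are its
  marginals; equality of the joint law with the product of the marginals is independence.\<close>

lemma indep_vars_PiM_coordinates:
  assumes "\<And>i. i \<in> I \<Longrightarrow> prob_space (M i)" "I \<noteq> {}"
  shows "prob_space.indep_vars (PiM I M) M (\<lambda>i x. x i) I"
proof -
  interpret prob_space "PiM I M"
    by (rule prob_space_PiM) (use assms in auto)
  have "distr (PiM I M) (PiM I M) (\<lambda>x. \<lambda>i\<in>I. x i) = distr (PiM I M) (PiM I M) (\<lambda>x. x)"
    by (intro distr_cong) (auto simp: space_PiM PiE_iff restrict_extensional extensional_restrict)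
  also have "\<dots> = PiM I (\<lambda>i. distr (PiM I M) (M i) (\<lambda>x. x i))"
    unfolding distr_id2 using assms by (subst distr_id) (intro PiM_cong refl distr_PiM_component[symmetric]; auto)
  finally show ?thesis
    using assms by (subst indep_vars_iff_distr_eq_PiM') auto
qed

section \<open>Convolutions as laws of sums of independent variables\<close>

context
  fixes \<mu> C :: "nat \<Rightarrow> real measure"
  assumes \<mu>: "\<And>k. real_distribution (\<mu> k)"
    and C_0: "C 0 = return borel 0"
    and C_Suc: "\<And>k. C (Suc k) = (C k \<star> \<mu> k)"
begin

interpretation \<mu>: real_distribution "\<mu> k" for k
  by (rule \<mu>)

interpretation P: prob_space "PiM UNIV \<mu>"
  by (intro prob_space_PiM \<mu>.prob_space_axioms)

lemma borel_measurable_coordinate [measurable]: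
  "(\<lambda>x. x j) \<in> borel_measurable (PiM UNIV \<mu>)"
  using measurable_component_singleton[of j UNIV \<mu>]
  by (simp cong: measurable_cong_sets)

lemma distr_partial_sum_eq_convolution:
  "distr (PiM UNIV \<mu>) borel (\<lambda>x. \<Sum>j<k. x j) = C k"
proof (induction k)
  case 0
  show ?case
    by (simp add: C_0 P.distr_const)
next
  case (Suc k)
  have distr: "distr (PiM UNIV \<mu>) borel (\<lambda>x. x k) = \<mu> k"
    using distr_PiM_component[of UNIV \<mu> k] \<mu>.prob_space_axioms
    by (simp cong: distr_cong)
  have "P.indep_vars \<mu> (\<lambda>i x. x i) UNIV"
    by (intro indep_vars_PiM_coordinates \<mu>.prob_space_axioms) auto
  \<comment> \<open>Composing with the identity replaces the target spaces \<open>\<mu> i\<close> by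
    the common target \<open>borel\<close>, which has the same measurable sets, so that the
    coordinates can be summed.\<close>
  then have "P.indep_vars (\<lambda>_. borel) (\<lambda>i x. x i) UNIV"
    by (rule P.indep_vars_compose2[where Y = "\<lambda>_ x. x"]) (simp cong: measurable_cong_sets)
  then have "P.indep_vars (\<lambda>_. borel) (\<lambda>i x. x i) (insert k {..<k})"
    by (rule P.indep_vars_subset) auto
  then have "P.indep_var borel (\<lambda>x. x k) borel (\<lambda>x. \<Sum>j<k. x j)"
    by (intro P.indep_vars_sum) auto
  then have "distr (PiM UNIV \<mu>) borel (\<lambda>x. x k + (\<Sum>j<k. x j)) = (\<mu> k \<star> C k)"
    by (subst P.sum_indep_random_variable) (auto simp: Suc distr)
  \<comment> \<open>The independence argument puts the new factor on the left, while
    \<open>C_Suc\<close> has it on the right.\<close>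
  moreover have "(\<mu> k \<star> C k) = (C k \<star> \<mu> k)"
    unfolding Suc[symmetric] by (intro convolution_commutative \<mu>.finite_measure_axioms P.finite_measure_distr) auto
  ultimately show ?case
    by (simp add: C_Suc add.commute)
qed

lemma real_distribution_convolutions: "real_distribution (C k)"
  unfolding distr_partial_sum_eq_convolution[symmetric] by (rule P.real_distribution_distr) simp

text \<open>Countably many almost sure bounds hold simultaneously, so the comparison test makes the
  random series converge almost surely. The limit distribution is the law of its sum.\<close>

lemma weak_conv_convolutions:
  assumes bound: "\<And>k. AE x in \<mu> k. \<bar>x\<bar> \<le> r k" and "summable r"
  shows "\<exists>\<nu>. real_distribution \<nu> \<and> weak_conv_m C \<nu>"
proof -
  have "AE x in PiM UNIV \<mu>. \<bar>x k\<bar> \<le> r k" for k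
    using bound[of k] by (intro AE_PiM_component \<mu>.prob_space_axioms) auto
  then have "AE x in PiM UNIV \<mu>. \<forall>k. \<bar>x k\<bar> \<le> r k"
    by (simp add: AE_all_countable)
  then have "AE x in PiM UNIV \<mu>. (\<lambda>k. \<Sum>j<k. x j) \<longlonglongrightarrow> (\<Sum>j. x j)"
  proof eventually_elim
    case (elim x)
    then have "summable x"
      by (intro summable_comparison_test'[OF \<open>summable r\<close>, where N = 0]) simp
    then show ?case
      by (rule summable_LIMSEQ)
  qed
  \<comment> \<open>Where the series diverges, the infinite sum has an unspecified value; this
    happens only on a null set and does not affect the law.\<close>
  then have "weak_conv_m (\<lambda>k. distr (PiM UNIV \<mu>) borel (\<lambda>x. \<Sum>j<k. x j))
      (distr (PiM UNIV \<mu>) borel (\<lambda>x. \<Sum>j. x j))"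
    by (intro P.AE_conv_imp_weak_conv_m) auto
  then show ?thesis
    unfolding distr_partial_sum_eq_convolution by (intro exI conjI P.real_distribution_distr) auto
qed

end

section \<open>Measurability of weak limits of kernels\<close>

lemma measurable_weak_limit:
  fixes L :: "'a \<Rightarrow> real measure"
  assumes K: "\<And>k. K k \<in> F \<rightarrow>\<^sub>M prob_algebra borel"
    and L: "\<And>\<omega>. \<omega> \<in> space F \<Longrightarrow> real_distribution (L \<omega>)"
    and conv: "\<And>\<omega>. \<omega> \<in> space F \<Longrightarrow> weak_conv_m (\<lambda>k. K k \<omega>) (L \<omega>)"
  shows "L \<in> F \<rightarrow>\<^sub>M prob_algebra borel"
proof (rule measurable_prob_algebra_generated)
  show "sets borel = sigma_sets UNIV (range (\<lambda>x::real. {..x}))"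
    by (simp add: borel_eq_atMost)
  show "Int_stable (range (\<lambda>x::real. {..x}))"
    by (auto simp: Int_stable_def)
  fix \<omega> assume \<omega>: "\<omega> \<in> space F"
  then interpret real_distribution "L \<omega>"
    by (rule L)
  show "prob_space (L \<omega>)" "sets (L \<omega>) = sets borel"
    by (simp_all add: prob_space_axioms)
next
  have Kdistr: "real_distribution (K k \<omega>)" if "\<omega> \<in> space F" for k \<omega>
    using measurable_space[OF K[of k] that]
    by (simp add: space_prob_algebra real_distribution_def real_distribution_axioms_def)
  \<comment> \<open>Half-lines cannot be tested directly: weak convergence may fail to give
    convergence of their measures when the endpoint is an atom of the limit. The cutoff
    \<open>cts_step a b\<close> is 1 up to \<open>a\<close>, 0 from \<open>b\<close> on and linear
    between.\<close>
  have int: "(\<lambda>\<omega>. integral\<^sup>L (L \<omega>) (cts_step a b)) \<in> borel_measurable F" if "a < b" for a b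
  proof (rule borel_measurable_LIMSEQ_real)
    have [measurable]: "cts_step a b \<in> borel_measurable borel"
      unfolding cts_step_def[abs_def] by measurable
    show "(\<lambda>\<omega>. integral\<^sup>L (K k \<omega>) (cts_step a b)) \<in> borel_measurable F" for k
      by (rule measurable_compose[OF measurable_prob_algebraD[OF K]])
        (rule integral_measurable_subprob_algebra, simp)
    fix \<omega> assume \<omega>: "\<omega> \<in> space F"
    have "isCont (cts_step a b) x" for x
      using cts_step_uniformly_continuous[OF that] uniformly_continuous_imp_continuous
      by (metis UNIV_I continuous_on_eq_continuous_at open_UNIV)
    moreover have "norm (cts_step a b x) \<le> 1" for x
      using that by (auto simp: cts_step_def)
    ultimately show "(\<lambda>k. integral\<^sup>L (K k \<omega>) (cts_step a b)) \<longlonglongrightarrow> integral\<^sup>L (L \<omega>) (cts_step a b)"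
      by (rule weak_conv_imp_integral_bdd_continuous_conv[OF Kdistr[OF \<omega>] L[OF \<omega>] conv[OF \<omega>]])
  qed
  fix A assume "A \<in> range (\<lambda>x::real. {..x})"
  then obtain x where A: "A = {..x}"
    by auto
  \<comment> \<open>The integral of \<open>cts_step x (y k)\<close> lies between the distribution
    function at \<open>x\<close> and at \<open>y k\<close>. As \<open>y k\<close> tends to
    \<open>x\<close> strictly from the right, right continuity closes the gap.\<close>
  define y where "y k = x + inverse (real (Suc k))" for k
  have y: "x < y k" for k
    by (simp add: y_def)
  have "(\<lambda>\<omega>. cdf (L \<omega>) x) \<in> borel_measurable F"
  proof (rule borel_measurable_LIMSEQ_real[OF _ int[OF y]])
    fix \<omega> assume "\<omega> \<in> space F"
    then interpret real_distribution "L \<omega>"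
      by (rule L)
    have "y \<longlonglongrightarrow> x"
      unfolding y_def using tendsto_add[OF tendsto_const LIMSEQ_inverse_real_of_nat] by simp
    then have "filterlim y (at_right x) sequentially"
      by (intro tendsto_imp_filterlim_at_right) (simp_all add: y)
    then have "(\<lambda>k. cdf (L \<omega>) (y k)) \<longlonglongrightarrow> cdf (L \<omega>) x"
      using cdf_is_right_cont[of x] by (auto simp: continuous_within intro: filterlim_compose)
    then show "(\<lambda>k. integral\<^sup>L (L \<omega>) (cts_step x (y k))) \<longlonglongrightarrow> cdf (L \<omega>) x"
      by (rule real_tendsto_sandwich[OF _ _ tendsto_const, rotated 2])
        (intro always_eventually allI cdf_cts_step y)+
  qed
  then have "(\<lambda>\<omega>. ennreal (cdf (L \<omega>) x)) \<in> borel_measurable F"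
    by simp
  also have "?this \<longleftrightarrow> (\<lambda>\<omega>. emeasure (L \<omega>) A) \<in> borel_measurable F"
  proof (rule measurable_cong)
    fix \<omega> assume "\<omega> \<in> space F"
    then interpret real_distribution "L \<omega>"
      by (rule L)
    show "ennreal (cdf (L \<omega>) x) = emeasure (L \<omega>) A"
      by (simp add: A cdf_def emeasure_eq_measure)
  qed
  finally show "(\<lambda>\<omega>. emeasure (L \<omega>) A) \<in> borel_measurable F" .
qed simp

section \<open>Functions of finitely many letters\<close>

text \<open>A word at distance less than \<open>2 powi (- int k)\<close> from \<alpha> shares its
  first \<open>k\<close> letters, so \<open>g\<close> is constant on that ball. Hence preimages
  under \<open>g\<close> are open.\<close>

lemma measurable_words_borel_prefix:
  assumes space: "\<And>\<omega>. \<omega> \<in> words m \<Longrightarrow> g \<omega> \<in> space M"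
    and prefix: "\<And>\<alpha> \<beta>. (\<And>i. i < k \<Longrightarrow> \<alpha> i = \<beta> i) \<Longrightarrow> g \<alpha> = g \<beta>"
  shows "g \<in> words_borel m \<rightarrow>\<^sub>M M"
proof (rule measurableI)
  interpret Metric_space "words m" word_dist
    by (rule Metric_space_words)
  fix A assume "A \<in> sets M"
  have "openin mtopology (g -` A \<inter> words m)"
    unfolding openin_mtopology
  proof (intro conjI allI impI exI)
    fix \<alpha> assume \<alpha>: "\<alpha> \<in> g -` A \<inter> words m"
    show "(2::real) powi (- int k) > 0"
      by simp
    show "mball \<alpha> (2 powi (- int k)) \<subseteq> g -` A \<inter> words m"
    proof
      fix \<beta> assume \<beta>: "\<beta> \<in> mball \<alpha> (2 powi (- int k))"
      have "\<alpha> i = \<beta> i" if "i < k" for i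
      proof (cases "\<alpha> = \<beta>")
        case False
        then have "(2::real) powi (- int (common_prefix_length \<alpha> \<beta>)) < 2 powi (- int k)"
          using \<beta> by (simp add: word_dist_def)
        then have "k \<le> common_prefix_length \<alpha> \<beta>"
          using power_int_increasing[of "- int k" "- int (common_prefix_length \<alpha> \<beta>)" "2::real"]
          by linarith
        then show ?thesis
          using False that by (simp add: common_prefix_length_ge_iff)
      qed simp
      then have "g \<alpha> = g \<beta>"
        by (rule prefix)
      with \<alpha> \<beta> show "\<beta> \<in> g -` A \<inter> words m"
        by auto
    qed
  qed auto
  then show "g -` A \<inter> space (words_borel m) \<in> sets (words_borel m)"
    by (auto simp: sets_words_borel)
qed (simp add: space)

lemma finite_convolution_prefix:
  assumes "\<And>i. i < k \<Longrightarrow> \<alpha> i = \<beta> i"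
  shows "finite_convolution N B n \<alpha> k = finite_convolution N B n \<beta> k"
  using assms
proof (induction k)
  case (Suc k)
  then have "(\<Prod>j\<le>k. N (\<alpha> j) powi (- int (n j))) = (\<Prod>j\<le>k. N (\<beta> j) powi (- int (n j)))"
    by (intro prod.cong) auto
  with Suc show ?case
    by simp
qed simp

section \<open>Averaged Dirac measures and decay of the scale factors\<close>

lemma real_distribution_average_dirac:
  assumes "finite D" "D \<noteq> {}"
  shows "real_distribution (average_dirac D)"
proof -
  have "emeasure (average_dirac D) UNIV = 1"
    using assms by (simp add: emeasure_average_dirac ennreal_divide_self of_nat_less_top less_top)
  then show ?thesis
    by (intro real_distribution.intro prob_spaceI real_distribution_axioms.intro) auto
qed

lemma AE_average_dirac:
  assumes "finite D"
  shows "AE x in average_dirac D. x \<in> D"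
proof (rule AE_I)
  show "emeasure (average_dirac D) (- D) = 0"
    using assms by (simp add: emeasure_average_dirac borel_closed finite_imp_closed)
qed (use assms in \<open>auto simp: borel_closed finite_imp_closed\<close>)

text \<open>Each factor is at most 1/2 because the base is at least 2 and the exponent at least 1;
  the indices \<open>0..k\<close> give \<open>Suc k\<close> factors.\<close>

lemma abs_scale_factor_le:
  fixes N :: "nat \<Rightarrow> real"
  assumes "\<And>j. N (\<omega> j) \<ge> 2" "\<And>j. n j \<ge> 1"
  shows "\<bar>\<Prod>j\<le>k. N (\<omega> j) powi (- int (n j))\<bar> \<le> (1/2) ^ Suc k"
proof -
  have "\<bar>N (\<omega> j) powi (- int (n j))\<bar> \<le> 1/2" for j
  proof -
    have "2 ^ 1 \<le> (2::real) ^ n j"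
      using assms(2)[of j] by (intro power_increasing) auto
    also have "\<dots> \<le> N (\<omega> j) ^ n j"
      using assms(1)[of j] by (intro power_mono) auto
    finally show ?thesis
      using assms(1)[of j] by (simp add: power_int_minus field_simps)
  qed
  then have "(\<Prod>j\<le>k. \<bar>N (\<omega> j) powi (- int (n j))\<bar>) \<le> (\<Prod>j\<le>k. 1/2)"
    by (intro prod_mono) auto
  then show ?thesis
    by (simp add: abs_prod)
qed

section \<open>Existence and measurability of the infinite convolution\<close>

context
  fixes m :: nat and N :: "nat \<Rightarrow> real" and B :: "nat \<Rightarrow> real set" and n :: "nat \<Rightarrow> nat"
  assumes N: "\<And>k. k \<in> {1..m} \<Longrightarrow> N k \<ge> 2"
    and B: "\<And>k. k \<in> {1..m} \<Longrightarrow> finite (B k) \<and> B k \<noteq> {}"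
    and n: "\<And>k. n k \<ge> 1"
begin

abbreviation scaled_digits :: "(nat \<Rightarrow> nat) \<Rightarrow> nat \<Rightarrow> real set" where
  "scaled_digits \<omega> k \<equiv> (\<lambda>a. (\<Prod>j\<le>k. N (\<omega> j) powi (- int (n j))) * a) ` B (\<omega> k)"

lemma real_distribution_scaled_digits:
  assumes "\<omega> \<in> words m"
  shows "real_distribution (average_dirac (scaled_digits \<omega> k))"
proof (rule real_distribution_average_dirac)
  have "\<omega> k \<in> {1..m}"
    using assms by (auto simp: words_def)
  from B[OF this] show "finite (scaled_digits \<omega> k)" "scaled_digits \<omega> k \<noteq> {}"
    by auto
qed

lemma real_distribution_finite_convolution:
  assumes "\<omega> \<in> words m"
  shows "real_distribution (finite_convolution N B n \<omega> k)"
  by (rule real_distribution_convolutions[where C = "finite_convolution N B n \<omega>",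
        OF real_distribution_scaled_digits[OF assms]]) simp_all

text \<open>The definite description yields its defining property only after existence and
  uniqueness of the limit are known. Existence comes from the geometric decay of the
  supports.\<close>

lemma infinite_convolution:
  assumes \<omega>: "\<omega> \<in> words m"
  shows "real_distribution (infinite_convolution N B n \<omega>)"
    and "weak_conv_m (finite_convolution N B n \<omega>) (infinite_convolution N B n \<omega>)"
proof -
  have range: "\<omega> j \<in> {1..m}" for j
    using \<omega> by (auto simp: words_def)
  \<comment> \<open>The alphabet is finite, so one bound \<open>R\<close> serves the digits of all
    letters, and the supports are bounded by the summable sequence
    \<open>(1/2) ^ Suc k * R\<close>.\<close>
  have "finite (\<Union>l\<in>{1..m}. B l)"
    using B by auto
  then obtain R where R: "\<And>a. a \<in> (\<Union>l\<in>{1..m}. B l) \<Longrightarrow> \<bar>a\<bar> \<le> R"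
    using finite_imp_bounded[THEN bounded_real[THEN iffD1]] by blast
  have "\<exists>\<nu>. real_distribution \<nu> \<and> weak_conv_m (finite_convolution N B n \<omega>) \<nu>"
  proof (rule weak_conv_convolutions[OF real_distribution_scaled_digits[OF \<omega>]])
    fix k
    show "AE x in average_dirac (scaled_digits \<omega> k). \<bar>x\<bar> \<le> (1/2) ^ Suc k * R"
    proof -
      have "\<bar>x\<bar> \<le> (1/2) ^ Suc k * R" if x: "x \<in> scaled_digits \<omega> k" for x
      proof -
        obtain a where a: "a \<in> B (\<omega> k)" "x = (\<Prod>j\<le>k. N (\<omega> j) powi (- int (n j))) * a"
          using x by auto
        have "\<bar>a\<bar> \<le> R"
          using a range by (intro R) blast
        then show ?thesis
          unfolding a(2) abs_mult
          using N range n by (intro mult_mono abs_scale_factor_le) auto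
      qed
      moreover have "AE x in average_dirac (scaled_digits \<omega> k). x \<in> scaled_digits \<omega> k"
        using B range by (intro AE_average_dirac) auto
      ultimately show ?thesis
        by (rule eventually_mono[rotated])
    qed
  next
    show "summable (\<lambda>k. (1/2) ^ Suc k * R)"
      by (intro summable_mult2 summable_ignore_initial_segment[of _ 1, simplified] summable_geometric) simp
  qed simp_all
  then have "\<exists>!\<nu>. real_distribution \<nu> \<and> weak_conv_m (finite_convolution N B n \<omega>) \<nu>"
  proof (rule ex_ex1I)
    fix \<nu> \<nu>'
    assume "real_distribution \<nu> \<and> weak_conv_m (finite_convolution N B n \<omega>) \<nu>"
      and "real_distribution \<nu>' \<and> weak_conv_m (finite_convolution N B n \<omega>) \<nu>'"
    then show "\<nu> = \<nu>'"
      by (auto intro: weak_conv_m_unique[OF real_distribution_finite_convolution[OF \<omega>]])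
  qed
  from theI'[OF this] show "real_distribution (infinite_convolution N B n \<omega>)"
    and "weak_conv_m (finite_convolution N B n \<omega>) (infinite_convolution N B n \<omega>)"
    by (fold infinite_convolution_def) simp_all
qed

lemma measurable_infinite_convolution:
  "infinite_convolution N B n \<in> words_borel m \<rightarrow>\<^sub>M prob_algebra borel"
proof (rule measurable_weak_limit[where K = "\<lambda>k \<omega>. finite_convolution N B n \<omega> k"])
  show "(\<lambda>\<omega>. finite_convolution N B n \<omega> k) \<in> words_borel m \<rightarrow>\<^sub>M prob_algebra borel" for k
  proof (rule measurable_words_borel_prefix)
    fix \<omega> assume "\<omega> \<in> words m"
    then interpret real_distribution "finite_convolution N B n \<omega> k"
      by (rule real_distribution_finite_convolution)
    show "finite_convolution N B n \<omega> k \<in> space (prob_algebra borel)"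
      by (simp add: space_prob_algebra prob_space_axioms)
  qed (rule finite_convolution_prefix)
qed (simp_all add: infinite_convolution)

end

theorem theorem1p1:
  fixes m :: nat and N :: "nat \<Rightarrow> real" and B :: "nat \<Rightarrow> real set" and n :: "nat \<Rightarrow> nat"
  assumes "m \<ge> 1"
    and "\<And>k. k \<in> {1..m} \<Longrightarrow> N k \<ge> 2"
    and "\<And>k. k \<in> {1..m} \<Longrightarrow> finite (B k) \<and> B k \<noteq> {}"
    and "\<And>k. n k \<ge> 1"
  shows "random_measure (words_borel m) (borel :: real measure)
    (\<lambda>\<omega> A. emeasure (infinite_convolution N B n \<omega>) A)"
  unfolding random_measure_def
proof (intro conjI ballI)
  \<comment> \<open>Measurability into \<open>prob_algebra borel\<close> contains the measurability
    of evaluation at every Borel set.\<close>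
  note meas = measurable_infinite_convolution[OF assms(2-4)]
  show "(\<lambda>\<omega>. emeasure (infinite_convolution N B n \<omega>) A) \<in> borel_measurable (words_borel m)"
    if "A \<in> sets borel" for A
    using measurable_emeasure_kernel[OF measurable_prob_algebraD[OF meas] that] .
  fix \<omega> assume "\<omega> \<in> space (words_borel m)"
  then interpret real_distribution "infinite_convolution N B n \<omega>"
    using infinite_convolution(1)[OF assms(2-4)] by simp
  show "measure_space (space borel) (sets borel) (emeasure (infinite_convolution N B n \<omega>))"
    using measure_space[of "infinite_convolution N B n \<omega>"] by simp
qed

end
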